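(* Let $n = p_1^{\alpha_1}\cdots p_r^{\alpha_r}$ be the prime factorisation of a positive integer $n$ (distinct primes, $\alpha_j>0$). Then the set of primes dividing at least one diagonal entry of the diagonal matrix $\bigotimes_{j=1}^r S(A_{p_j^{\alpha_j}})$ (Kronecker product) is $\{p_1,\dots,p_r\}$, and for each $j$ the weakly decreasing rearrangement of the exponents of $p_j$ in the $n$ diagonal entries consists of the value $\alpha_j - i$ repeated $\phi(p_j^i)\, n / p_j^{\alpha_j}$ times, for $0 \le i \le \alpha_j$.
   Context: For a positive integer $k$, let $\Phi_d$ denote the $d$th cyclotomic polynomial and let $\Psi_k : \mathbf{Z}[X]/(X^k-1) \to \bigoplus_{d \mid k} \mathbf{Z}[X]/(\Phi_d(X))$ be the natural map $f \bmod (X^k-1) \mapsto \bigoplus_{d\mid k} f \bmod \Phi_d(X)$, with bases $(1,\overline{X},\dots,\overline{X}^{k-1})$ on the domain, $(1,\overline{X},\dots,\overline{X}^{\phi(d)-1})$ on each summand, summands ordered by increasing $d$; $A_k$ is the matrix of $\Psi_k$ in these bases. $S(A)$ denotes the Smith normal form of an integer matrix $A$ with non-negative diagonal entries. $\phi$ is Euler's totient function. *)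

theory Defs
  imports Complex_Main "HOL-Computational_Algebra.Polynomial" "HOL-Number_Theory.Totient"
    "Jordan_Normal_Form.Matrix"
begin

definition cyclotomic_complex :: "nat \<Rightarrow> complex poly" where
  "cyclotomic_complex d =
     (\<Prod>j\<in>{j. 1 \<le> j \<and> j \<le> d \<and> coprime j d}. [:- cis (2 * pi * real j / real d), 1:])"

(* the same polynomial viewed in Z[X] (it has integer coefficients) *)
definition cyclotomic :: "nat \<Rightarrow> int poly" where
  "cyclotomic d = (THE f. map_poly of_int f = cyclotomic_complex d)"

definition xpow_mod_cyclo :: "nat \<Rightarrow> nat \<Rightarrow> int poly" where
  "xpow_mod_cyclo c d =
     (THE r. (r = 0 \<or> degree r < totient d) \<and> cyclotomic d dvd (monom 1 c - r))"

definition psi_rows :: "nat \<Rightarrow> (nat \<times> nat) list" where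
  "psi_rows k = concat (map (\<lambda>d. map (\<lambda>t. (d, t)) [0..<totient d])
                          (sorted_list_of_set {d. d dvd k}))"

definition psi_matrix :: "nat \<Rightarrow> int mat" where
  "psi_matrix k = mat (length (psi_rows k)) k
     (\<lambda>(i, c). coeff (xpow_mod_cyclo c (fst (psi_rows k ! i))) (snd (psi_rows k ! i)))"

definition is_smith_nf :: "int mat \<Rightarrow> int mat \<Rightarrow> bool" where
  "is_smith_nf A S \<longleftrightarrow>
     (\<exists>P Q. P \<in> carrier_mat (dim_row A) (dim_row A) \<and> Q \<in> carrier_mat (dim_col A) (dim_col A)
        \<and> invertible_mat P \<and> invertible_mat Q \<and> S = P * A * Q)
     \<and> S \<in> carrier_mat (dim_row A) (dim_col A)
     \<and> (\<forall>i<dim_row A. \<forall>j<dim_col A. i \<noteq> j \<longrightarrow> S $$ (i, j) = 0)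
     \<and> (\<forall>i<min (dim_row A) (dim_col A). S $$ (i, i) \<ge> 0)
     \<and> (\<forall>i. i + 1 < min (dim_row A) (dim_col A) \<longrightarrow> S $$ (i, i) dvd S $$ (i + 1, i + 1))"

definition smith_nf :: "int mat \<Rightarrow> int mat" where
  "smith_nf A = (THE S. is_smith_nf A S)"

definition kronecker :: "'a::times mat \<Rightarrow> 'a mat \<Rightarrow> 'a mat" where
  "kronecker A B = mat (dim_row A * dim_row B) (dim_col A * dim_col B)
     (\<lambda>(i, j). A $$ (i div dim_row B, j div dim_col B) * B $$ (i mod dim_row B, j mod dim_col B))"

definition kronecker_list :: "'a::semiring_1 mat list \<Rightarrow> 'a mat" where
  "kronecker_list As = foldr kronecker As (1\<^sub>m 1)"

end

theory Submission
  imports Defs "Jordan_Normal_Form.Determinant"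
begin

text \<open>Put \<open>q = p ^ a\<close>. Since \<open>\<Phi>\<^bsub>pq\<^esub>(X) = 1 + X\<^sup>q + \<dots> + X\<^bsup>(p - 1)q\<^esup>\<close>, unimodular row and column
  operations turn \<open>A\<^bsub>pq\<^esub>\<close> into the block diagonal matrix with blocks \<open>1\<close> (of size \<open>\<phi>(pq)\<close>) and
  \<open>p A\<^bsub>q\<^esub>\<close>. By induction the Smith normal form of \<open>A\<^bsub>p ^ a\<^esub>\<close> has \<open>p ^ (a - i)\<close> with multiplicity
  \<open>\<phi>(p ^ i)\<close> on its diagonal. In the Kronecker product over the primes dividing \<open>n\<close>, only the factor
  belonging to \<open>p\<close> contributes to the exponents of \<open>p\<close>, and each of its diagonal entries is repeated
  \<open>n / p ^ \<alpha>\<close> times.\<close>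

section \<open>Uniqueness of the Smith normal form\<close>

lemma invertible_mat_carrierE:
  assumes "invertible_mat P" "P \<in> carrier_mat n n"
  obtains P' where "P' \<in> carrier_mat n n" "P * P' = 1\<^sub>m n" "P' * P = 1\<^sub>m n"
proof -
  from assms obtain P' where *: "P * P' = 1\<^sub>m n" "P' * P = 1\<^sub>m (dim_row P')"
    by (auto simp: invertible_mat_def inverts_mat_def)
  have "dim_col P' = n" using arg_cong[OF *(1), of dim_col] by simp
  moreover have "dim_row P' = n" using arg_cong[OF *(2), of dim_col] assms by simp
  ultimately show ?thesis using * that[of P'] by auto
qed

lemma invertible_matI:
  assumes "P \<in> carrier_mat n n" "P' \<in> carrier_mat n n" "P * P' = 1\<^sub>m n" "P' * P = 1\<^sub>m n"
  shows "invertible_mat P"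
  using assms by (auto simp: invertible_mat_def inverts_mat_def)

lemma invertible_mat_mult:
  fixes P Q :: "'a::comm_ring_1 mat"
  assumes P: "P \<in> carrier_mat n n" "invertible_mat P" and Q: "Q \<in> carrier_mat n n" "invertible_mat Q"
  shows "invertible_mat (P * Q)"
proof -
  obtain P' where P': "P' \<in> carrier_mat n n" "P * P' = 1\<^sub>m n" "P' * P = 1\<^sub>m n"
    using invertible_mat_carrierE[OF P(2,1)] by blast
  obtain Q' where Q': "Q' \<in> carrier_mat n n" "Q * Q' = 1\<^sub>m n" "Q' * Q = 1\<^sub>m n"
    using invertible_mat_carrierE[OF Q(2,1)] by blast
  have "P * Q * (Q' * P') = P * (Q * Q') * P'" "Q' * P' * (P * Q) = Q' * (P' * P) * Q"
    using P(1) Q(1) P'(1) Q'(1) by (simp_all add: assoc_mult_mat[of _ n n _ n _ n])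
  then show ?thesis
    using P(1) Q(1) P' Q' by (intro invertible_matI[of _ n "Q' * P'"]) auto
qed

lemma invertible_four_block_diag:
  fixes P :: "'a::comm_ring_1 mat"
  assumes P: "P \<in> carrier_mat n n" "invertible_mat P"
  shows "invertible_mat (four_block_mat (1\<^sub>m m) (0\<^sub>m m n) (0\<^sub>m n m) P)"
proof -
  obtain P' where P': "P' \<in> carrier_mat n n" "P * P' = 1\<^sub>m n" "P' * P = 1\<^sub>m n"
    using invertible_mat_carrierE[OF P(2,1)] by blast
  show ?thesis
    using P(1) P' by (intro invertible_matI[of _ "m + n" "four_block_mat (1\<^sub>m m) (0\<^sub>m m n) (0\<^sub>m n m) P'"])
      (auto simp: mult_four_block_mat[of _ m m _ n _ n _ _ m _ n])
qed

section \<open>Comparison of two Smith forms of the same matrix\<close>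

text \<open>Pigeonhole: the \<open>n - k\<close> indices from \<open>k\<close> on cannot be mapped
  injectively into the \<open>n - k - 1\<close> indices beyond \<open>k\<close>.\<close>

lemma permutes_hits_block:
  fixes n k :: nat
  assumes "\<sigma> permutes {0..<n}" "k < n"
  shows "\<exists>i<n. k \<le> i \<and> \<sigma> i \<le> k"
proof (rule ccontr)
  assume "\<not> ?thesis"
  then have "\<sigma> i \<in> {k<..<n}" if "i \<in> {k..<n}" for i
    using permutes_in_image[OF assms(1), of i] that by (auto simp: not_le)
  then have "\<sigma> ` {k..<n} \<subseteq> {k<..<n}" by blast
  moreover have "card (\<sigma> ` {k..<n}) = n - k"
    using permutes_inj[OF assms(1)] by (simp add: card_image inj_on_subset)
  ultimately have "n - k \<le> card {k<..<n}" by (metis card_mono finite_greaterThanLessThan)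
  then show False using assms by simp
qed

text \<open>Every Leibniz term of \<^term>\<open>det V\<close> has a factor in the block of rows \<open>\<ge> k\<close> and columns
  \<open>\<le> k\<close>, because that block has \<open>n + 1\<close> rows and columns in total.\<close>

lemma dvd_det_of_dvd_block:
  fixes V :: "int mat"
  assumes V: "V \<in> carrier_mat n n" and k: "k < n"
    and block: "\<And>i j. k \<le> i \<Longrightarrow> i < n \<Longrightarrow> j \<le> k \<Longrightarrow> s dvd V $$ (i, j) * t"
  shows "s dvd det V * t"
proof -
  have "s dvd signof \<sigma> * (\<Prod>i = 0..<n. V $$ (i, \<sigma> i)) * t" if \<sigma>: "\<sigma> permutes {0..<n}" for \<sigma>
  proof -
    obtain i where i: "i < n" "k \<le> i" "\<sigma> i \<le> k" using permutes_hits_block[OF \<sigma> k] by auto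
    have "(\<Prod>i = 0..<n. V $$ (i, \<sigma> i)) = V $$ (i, \<sigma> i) * (\<Prod>i \<in> {0..<n} - {i}. V $$ (i, \<sigma> i))"
      using i by (intro prod.remove) auto
    then have "signof \<sigma> * (\<Prod>i = 0..<n. V $$ (i, \<sigma> i)) * t =
        V $$ (i, \<sigma> i) * t * (signof \<sigma> * (\<Prod>i \<in> {0..<n} - {i}. V $$ (i, \<sigma> i)))"
      by (simp only: mult_ac)
    then show ?thesis using block[OF i(2,1,3)] by (metis dvd_mult2)
  qed
  then show ?thesis
    unfolding det_def'[OF V] sum_distrib_right by (intro dvd_sum) simp
qed

lemma diagonal_mult_entry:
  fixes S U :: "'a::comm_ring_1 mat"
  assumes "S \<in> carrier_mat n n" "U \<in> carrier_mat n n" "i < n" "j < n"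
    and "\<forall>i<n. \<forall>j<n. i \<noteq> j \<longrightarrow> S $$ (i, j) = 0"
  shows "(S * U) $$ (i, j) = S $$ (i, i) * U $$ (i, j)"
    and "(U * S) $$ (i, j) = U $$ (i, j) * S $$ (j, j)"
proof -
  have "(\<Sum>k = 0..<n. S $$ (i, k) * U $$ (k, j)) = (\<Sum>k = 0..<n. if k = i then S $$ (i, i) * U $$ (i, j) else 0)"
    using assms by (intro sum.cong) auto
  then show "(S * U) $$ (i, j) = S $$ (i, i) * U $$ (i, j)"
    using assms by (simp add: scalar_prod_def)
  have "(\<Sum>k = 0..<n. U $$ (i, k) * S $$ (k, j)) = (\<Sum>k = 0..<n. if k = j then U $$ (i, j) * S $$ (j, j) else 0)"
    using assms by (intro sum.cong) auto
  then show "(U * S) $$ (i, j) = U $$ (i, j) * S $$ (j, j)"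
    using assms by (simp add: scalar_prod_def)
qed

lemma dvd_chain_le:
  fixes f :: "nat \<Rightarrow> 'a::comm_monoid_mult"
  assumes "\<And>i. i + 1 < n \<Longrightarrow> f i dvd f (i + 1)" "i \<le> j" "j < n"
  shows "f i dvd f j"
  using assms(2,3)
proof (induction j rule: dec_induct)
  case (step j)
  then show ?case using assms(1)[of j] by (auto intro: dvd_trans)
qed simp

text \<open>Two Smith forms of \<open>A\<close> satisfy \<open>S * U = V * T\<close> with
  \<open>det V\<close> a unit. Comparing entries shows that \<open>S $$ (k, k)\<close> divides
  \<open>V $$ (i, j) * T $$ (k, k)\<close> on the whole block \<open>i \<ge> k\<close>,
  \<open>j \<le> k\<close>. Hence it divides \<open>det V * T $$ (k, k)\<close>, and no gcds of
  minors are needed.\<close>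

lemma smith_nf_entry_dvd:
  fixes A S T :: "int mat"
  assumes A: "A \<in> carrier_mat n n" and S: "is_smith_nf A S" and T: "is_smith_nf A T"
    and k: "k < n"
  shows "S $$ (k, k) dvd T $$ (k, k)"
proof -
  have [simp]: "dim_row A = n" "dim_col A = n" using A by auto
  obtain P Q where PQ: "P \<in> carrier_mat n n" "Q \<in> carrier_mat n n" "invertible_mat P"
      "invertible_mat Q" "S = P * A * Q"
    using S by (auto simp: is_smith_nf_def)
  obtain P' Q' where PQ': "P' \<in> carrier_mat n n" "Q' \<in> carrier_mat n n" "invertible_mat P'"
      "invertible_mat Q'" "T = P' * A * Q'"
    using T by (auto simp: is_smith_nf_def)
  have S': "S \<in> carrier_mat n n" "\<forall>i<n. \<forall>j<n. i \<noteq> j \<longrightarrow> S $$ (i, j) = 0"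
      "\<And>i. i + 1 < n \<Longrightarrow> S $$ (i, i) dvd S $$ (i + 1, i + 1)"
    and T': "T \<in> carrier_mat n n" "\<forall>i<n. \<forall>j<n. i \<noteq> j \<longrightarrow> T $$ (i, j) = 0"
      "\<And>i. i + 1 < n \<Longrightarrow> T $$ (i, i) dvd T $$ (i + 1, i + 1)"
    using S T by (auto simp: is_smith_nf_def)
  obtain Pi where Pi: "Pi \<in> carrier_mat n n" "P * Pi = 1\<^sub>m n" "Pi * P = 1\<^sub>m n"
    using invertible_mat_carrierE PQ by blast
  obtain Pi' where Pi': "Pi' \<in> carrier_mat n n" "P' * Pi' = 1\<^sub>m n" "Pi' * P' = 1\<^sub>m n"
    using invertible_mat_carrierE PQ' by blast
  obtain Qi where Qi: "Qi \<in> carrier_mat n n" "Q * Qi = 1\<^sub>m n" "Qi * Q = 1\<^sub>m n"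
    using invertible_mat_carrierE PQ by blast
  \<comment> \<open>Obtained by solving for \<open>A\<close>: \<open>S\<close> times
    \<open>Q\<close>-inverse times \<open>Q'\<close> equals \<open>P * A * Q'\<close>, which is
    \<open>P\<close> times \<open>P'\<close>-inverse times \<open>T\<close>.\<close>
  define U V where "U = Qi * Q'" and "V = P * Pi'"
  have UV: "U \<in> carrier_mat n n" "V \<in> carrier_mat n n"
    using PQ PQ' Qi Pi' by (auto simp: U_def V_def)
  have "S * U = P * A * (Q * Qi) * Q'"
    unfolding U_def PQ(5) using A PQ PQ' Qi(1) by (simp add: assoc_mult_mat[of _ n n _ n _ n])
  also have "\<dots> = P * (Pi' * P') * A * Q'"
    using A PQ PQ' Qi Pi' by simp
  also have "\<dots> = V * T"
    unfolding V_def PQ'(5) using A PQ PQ' Pi'(1) by (simp add: assoc_mult_mat[of _ n n _ n _ n])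
  finally have SU: "S * U = V * T" .
  have "V * (P' * Pi) = P * (Pi' * P') * Pi"
    unfolding V_def using PQ PQ' Pi(1) Pi'(1) by (simp add: assoc_mult_mat[of _ n n _ n _ n])
  also have "\<dots> = 1\<^sub>m n" using PQ Pi Pi' by simp
  finally have "det V * det (P' * Pi) = 1"
    using det_mult[OF UV(2), of "P' * Pi"] PQ' Pi by simp
  then have unit: "det V dvd 1" by (metis dvd_triv_left)
  have "S $$ (k, k) dvd V $$ (i, j) * T $$ (k, k)" if ij: "k \<le> i" "i < n" "j \<le> k" for i j
  proof -
    \<comment> \<open>Entry \<open>(i, j)\<close> of \<open>S * U = V * T\<close>. The two
      divisibility chains then replace \<open>S $$ (i, i)\<close> by its divisor
      \<open>S $$ (k, k)\<close> and \<open>T $$ (j, j)\<close> by its multiple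
      \<open>T $$ (k, k)\<close>.\<close>
    have "S $$ (i, i) * U $$ (i, j) = V $$ (i, j) * T $$ (j, j)"
      using diagonal_mult_entry(1)[OF S'(1) UV(1) _ _ S'(2), of i j]
        diagonal_mult_entry(2)[OF T'(1) UV(2) _ _ T'(2), of i j] SU ij k by simp
    moreover have "S $$ (k, k) dvd S $$ (i, i)" 
      using dvd_chain_le[of n "\<lambda>i. S $$ (i, i)", OF S'(3)] ij by simp
    ultimately have "S $$ (k, k) dvd V $$ (i, j) * T $$ (j, j)" by (metis dvd_mult2)
    moreover have "T $$ (j, j) dvd T $$ (k, k)"
      using dvd_chain_le[of n "\<lambda>i. T $$ (i, i)", OF T'(3)] ij k by simp
    ultimately show ?thesis by (meson dvd_trans dvd_refl mult_dvd_mono)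
  qed
  then have "S $$ (k, k) dvd det V * T $$ (k, k)"
    using dvd_det_of_dvd_block[OF UV(2) k] by blast
  then show ?thesis using unit by (metis dvd_mult_unit_iff mult.commute)
qed

lemma smith_nf_eqI:
  assumes A: "A \<in> carrier_mat n n" and S: "is_smith_nf A S"
  shows "smith_nf A = S"
  unfolding smith_nf_def
proof (rule the_equality)
  show "is_smith_nf A S" by (rule S)
next
  fix T assume T: "is_smith_nf A T"
  have d: "T \<in> carrier_mat n n" "S \<in> carrier_mat n n" using A S T by (auto simp: is_smith_nf_def)
  have "T $$ (k, k) = S $$ (k, k)" if "k < n" for k
    using smith_nf_entry_dvd[OF A S T that] smith_nf_entry_dvd[OF A T S that] S T A that
    by (intro zdvd_antisym_nonneg) (auto simp: is_smith_nf_def)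
  moreover have "T $$ (i, j) = S $$ (i, j)" if "i < n" "j < n" "i \<noteq> j" for i j
    using S T A that by (auto simp: is_smith_nf_def)
  ultimately have "T $$ (i, j) = S $$ (i, j)" if "i < n" "j < n" for i j
    using that by (cases "i = j") simp_all
  then show "T = S" using d by (intro eq_matI) auto
qed

section \<open>Cyclotomic polynomials of prime power order\<close>

text \<open>Both sides have degree at most \<open>d\<close> and the same coefficient at
  \<open>d\<close>, and they agree at the \<open>d\<close> roots of unity.\<close>

lemma prod_roots_of_unity:
  assumes "d > 0"
  shows "(\<Prod>j = 1..d. [:- cis (2 * pi * real j / real d), 1:]) = monom 1 d - 1" (is "?L = _")
proof (rule poly_eqI_degree_lead_coeff[where n = d and A = "{z. z ^ d = 1}"])
  have deg: "degree ?L = d" by (subst degree_prod_eq_sum_degree) auto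
  have "lead_coeff ?L = 1" by (subst lead_coeff_prod) auto
  then show "coeff ?L d = coeff (monom 1 d - 1) d" using deg assms by (simp add: coeff_1)
  show "degree ?L \<le> d" using deg by simp
  show "degree (monom 1 d - 1 :: complex poly) \<le> d"
    by (intro degree_diff_le degree_monom_le) simp
  show "d \<le> card {z::complex. z ^ d = 1}" using card_roots_unity_eq[of d] assms by simp
next
  fix z :: complex assume z: "z \<in> {z. z ^ d = 1}"
  then obtain k where k: "k < d" "z = cis (2 * pi * real k / real d)"
    using bij_betw_roots_unity[OF assms] by (auto simp: bij_betw_def image_iff)
  have "\<exists>j \<in> {1..d}. z = cis (2 * pi * real j / real d)"
  \<comment> \<open>The product runs over \<open>1..d\<close>, so the root 1 is reached at
    \<open>j = d\<close> and not at 0.\<close>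
  proof (cases "k = 0")
    case True
    then show ?thesis using k assms by (intro bexI[of _ d]) auto
  next
    case False
    then show ?thesis using k by (intro bexI[of _ k]) auto
  qed
  then have "poly ?L z = 0" by (auto simp: poly_prod intro!: prod_zero)
  then show "poly ?L z = poly (monom 1 d - 1) z" using z by (simp add: poly_monom)
qed

lemma monom_1_mult_eq_power: "monom (1::'a::comm_semiring_1) (m * q) = monom 1 q ^ m"
  by (simp add: monom_power mult.commute)

lemma monom_1_minus_1_factor:
  "monom (1::'a::comm_ring_1) (m * q) - 1 = (monom 1 q - 1) * (\<Sum>i<m. monom 1 (i * q))"
  by (simp add: monom_1_mult_eq_power power_diff_1_eq)

lemma monom_1_minus_1_neq_0: "q > 0 \<Longrightarrow> monom (1::'a::comm_ring_1) q - 1 \<noteq> 0"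
  by (metis monom_eq_1_iff eq_iff_diff_eq_0 less_numeral_extra(3))

text \<open>The indices up to \<open>p ^ Suc a\<close> are either prime to \<open>p\<close> or
  multiples of \<open>p\<close>. The former give the cyclotomic polynomial, the latter
  \<open>X^(p^a) - 1\<close>. Cancelling this factor from \<open>X^(p^(a+1)) - 1\<close> leaves the
  geometric sum.\<close>

lemma cyclotomic_complex_prime_power:
  assumes p: "prime p"
  shows "cyclotomic_complex (p ^ Suc a) = (\<Sum>m<p. monom 1 (m * p ^ a))"
proof -
  let ?f = "\<lambda>j. [:- cis (2 * pi * real j / real (p ^ Suc a)), 1:]"
  let ?C = "{j. 1 \<le> j \<and> j \<le> p ^ Suc a \<and> coprime j (p ^ Suc a)}"
  have p0: "p > 0" using p prime_gt_0_nat by blast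
  have cop: "coprime j (p ^ Suc a) \<longleftrightarrow> \<not> p dvd j" for j
    using prime_imp_coprime[OF p, of j] p coprime_common_divisor[of j p p]
      not_prime_1
    by (auto simp: coprime_power_right_iff coprime_commute[of j] simp del: power_Suc)
  have split: "{1..p ^ Suc a} = ?C \<union> (\<lambda>j. p * j) ` {1..p ^ a}"
  proof (intro equalityI subsetI)
    fix j assume j: "j \<in> {1..p ^ Suc a}"
    show "j \<in> ?C \<union> (\<lambda>j. p * j) ` {1..p ^ a}"
    proof (cases "p dvd j")
      case True
      then obtain j' where "j = p * j'" by auto
      then show ?thesis using j p0 by (auto simp: Suc_le_eq)
    next
      case False
      then show ?thesis using j cop by auto
    qed
  next
    fix j assume "j \<in> ?C \<union> (\<lambda>j. p * j) ` {1..p ^ a}"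
    then show "j \<in> {1..p ^ Suc a}" using p0 by (auto simp: Suc_le_eq)
  qed
  have "monom 1 (p ^ Suc a) - 1 = (\<Prod>j = 1..p ^ Suc a. ?f j)"
    using prod_roots_of_unity[of "p ^ Suc a"] p0 by simp
  also have "\<dots> = cyclotomic_complex (p ^ Suc a) * (\<Prod>j \<in> (\<lambda>j. p * j) ` {1..p ^ a}. ?f j)"
    unfolding split cyclotomic_complex_def
    using prime_gt_1_nat[OF p]
    by (intro prod.union_disjoint) (auto simp: cop simp del: power_Suc)
  also have "(\<Prod>j \<in> (\<lambda>j. p * j) ` {1..p ^ a}. ?f j) =
      (\<Prod>j = 1..p ^ a. [:- cis (2 * pi * real j / real (p ^ a)), 1:])"
    using p0 by (subst prod.reindex) (auto intro: inj_onI simp: mult.assoc)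
  also have "\<dots> = monom 1 (p ^ a) - 1"
    using prod_roots_of_unity[of "p ^ a"] p0 by simp
  finally have "(monom 1 (p ^ a) - 1) * cyclotomic_complex (p ^ Suc a) =
      (monom 1 (p ^ a) - 1) * (\<Sum>m<p. monom 1 (m * p ^ a))"
    using monom_1_minus_1_factor[of p "p ^ a", where 'a = complex] by (metis mult.commute power_Suc)
  then show ?thesis using monom_1_minus_1_neq_0[of "p ^ a", where 'a = complex] p0 by simp
qed

text \<open>The embedding of Z[X] in C[X] is injective, so exhibiting one integral preimage
  determines the \<open>THE\<close>. Integrality is thus settled case by case through an explicit
  \<open>f\<close>.\<close>

lemma cyclotomic_eqI:
  assumes "map_poly of_int f = cyclotomic_complex d"
  shows "cyclotomic d = f"
  unfolding cyclotomic_def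
proof (rule the_equality)
  show "map_poly of_int f = cyclotomic_complex d" by (rule assms)
next
  fix g :: "int poly" assume "map_poly of_int g = cyclotomic_complex d"
  then have "map_poly complex_of_int g = map_poly complex_of_int f" using assms by simp
  then show "g = f" by (simp add: poly_eq_iff coeff_map_poly)
qed

lemma cyclotomic_prime_power:
  assumes "prime p"
  shows "cyclotomic (p ^ Suc a) = (\<Sum>m<p. monom 1 (m * p ^ a))"
  by (rule cyclotomic_eqI, unfold cyclotomic_complex_prime_power[OF assms])
    (intro poly_eqI, auto simp: coeff_map_poly coeff_sum of_int_sum intro!: sum.cong)

lemma cyclotomic_1: "cyclotomic 1 = [:-1, 1:]"
proof (rule cyclotomic_eqI)
  have "{j. 1 \<le> j \<and> j \<le> (1::nat) \<and> coprime j 1} = {1}" by auto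
  then show "map_poly of_int [:-1, 1:] = cyclotomic_complex 1"
    by (simp add: cyclotomic_complex_def map_poly_pCons)
qed

lemma cyclotomic_prime_power_dvd:
  assumes "prime p"
  shows "cyclotomic (p ^ a) dvd monom 1 (p ^ a) - 1"
proof (cases a)
  case 0
  then show ?thesis using cyclotomic_1 by (simp add: monom_altdef one_pCons)
next
  case (Suc b)
  then show ?thesis
    using cyclotomic_prime_power[OF assms, of b] monom_1_minus_1_factor[of p "p ^ b"]
    by (metis dvd_triv_right power_Suc)
qed

text \<open>For a positive exponent \<open>Suc b\<close>, the top term of the geometric sum is
  \<open>X^((p-1) p^b)\<close>. This ties the bound \<open>totient\<close> in
  \<open>xpow_mod_cyclo\<close> to the degree of the divisor.\<close>

lemma degree_cyclotomic_prime_power: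
  assumes p: "prime p"
  shows "degree (cyclotomic (p ^ a)) = totient (p ^ a)"
proof (cases a)
  case 0
  then show ?thesis using cyclotomic_1 by simp
next
  case (Suc b)
  have p1: "p > 1" using p prime_gt_1_nat by blast
  have "coeff (cyclotomic (p ^ a)) (m * p ^ b) = (\<Sum>i<p. if i = m then 1 else 0)" for m
    unfolding Suc cyclotomic_prime_power[OF p] coeff_sum using p1 by (intro sum.cong) auto
  then have "coeff (cyclotomic (p ^ a)) (totient (p ^ a)) = (\<Sum>i<p. if i = p - 1 then 1 else 0)"
    using totient_prime_power_Suc[OF p, of b] unfolding Suc by (metis mult.commute)
  then have "coeff (cyclotomic (p ^ a)) (totient (p ^ a)) \<noteq> 0" using p1 by simp
  moreover have "degree (cyclotomic (p ^ a)) \<le> totient (p ^ a)"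
    unfolding Suc cyclotomic_prime_power[OF p] totient_prime_power_Suc[OF p]
    by (intro degree_sum_le order.trans[OF degree_monom_le]) auto
  ultimately show ?thesis by (intro antisym le_degree) auto
qed

section \<open>Remainders of powers of X modulo cyclotomic polynomials\<close>

lemma eq_0_of_dvd_degree_less:
  fixes f g :: "'a::idom poly"
  assumes "g dvd f" "f = 0 \<or> degree f < degree g"
  shows "f = 0"
  using dvd_imp_degree_le[OF assms(1)] assms(2) by (meson leD)

text \<open>Two candidate remainders differ by a multiple of the cyclotomic polynomial of smaller
  degree, hence by 0. Each remainder used below is therefore verified by giving it
  explicitly.\<close>

lemma xpow_mod_cyclo_prime_power_eqI:
  assumes p: "prime p" and r: "r = 0 \<or> degree r < totient (p ^ a)"
    and dvd: "cyclotomic (p ^ a) dvd monom 1 c - r"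
  shows "xpow_mod_cyclo c (p ^ a) = r"
  unfolding xpow_mod_cyclo_def
proof (rule the_equality)
  show "(r = 0 \<or> degree r < totient (p ^ a)) \<and> cyclotomic (p ^ a) dvd monom 1 c - r"
    using r dvd by blast
next
  fix s assume s: "(s = 0 \<or> degree s < totient (p ^ a)) \<and> cyclotomic (p ^ a) dvd monom 1 c - s"
  have "cyclotomic (p ^ a) dvd (monom 1 c - r) - (monom 1 c - s)" 
    using dvd_diff[OF dvd conjunct2[OF s]] .
  then have "cyclotomic (p ^ a) dvd s - r" by simp
  moreover have "s - r = 0 \<or> degree (s - r) < degree (cyclotomic (p ^ a))"
    using r s degree_cyclotomic_prime_power[OF p, of a] degree_diff_less by force
  ultimately have "s - r = 0" by (rule eq_0_of_dvd_degree_less)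
  then show "s = r" by simp
qed

text \<open>\<open>X^q\<close> is congruent to 1 because \<open>d\<close> divides \<open>q\<close>,
  so \<open>X^c\<close> and \<open>X^(c mod q)\<close> have the same candidate remainders. The two
  \<open>THE\<close> predicates coincide, and existence of a remainder is not at issue.\<close>

lemma xpow_mod_cyclo_mod:
  assumes "cyclotomic d dvd monom 1 d - 1" "d dvd q"
  shows "xpow_mod_cyclo (c mod q) d = xpow_mod_cyclo c d"
proof -
  have "cyclotomic d dvd monom 1 q - 1"
    using assms monom_1_minus_1_factor[of "q div d" d, where 'a = int]
    by (metis dvd_div_mult_self dvd_mult2)
  then have "cyclotomic d dvd monom 1 (c mod q) * (monom 1 (c div q * q) - 1)"
    unfolding monom_1_minus_1_factor by simp
  also have "monom 1 (c mod q) * (monom 1 (c div q * q) - 1) = (monom 1 c - monom 1 (c mod q) :: int poly)"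
    by (simp add: right_diff_distrib mult_monom)
  finally have *: "cyclotomic d dvd monom 1 c - monom 1 (c mod q)" .
  have "cyclotomic d dvd monom 1 (c mod q) - r \<longleftrightarrow> cyclotomic d dvd monom 1 c - r" for r
    using dvd_add_right_iff[OF *, of "monom 1 (c mod q) - r"] by simp
  then show ?thesis unfolding xpow_mod_cyclo_def by simp
qed

section \<open>The Smith normal form for a prime power\<close>

lemma totient_prime_power_Suc_add:
  assumes "prime p"
  shows "totient (p ^ Suc a) + p ^ a = p ^ Suc a"
  using prime_gt_0_nat[OF assms] totient_prime_power_Suc[OF assms, of a]
  by (cases p) (auto simp: algebra_simps)

text \<open>Exponents of \<open>p\<close> along the Smith diagonal, in increasing order. The
  recursion mirrors the block diagonal form: an identity block, then \<open>p\<close> times the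
  previous level.\<close>

fun smith_exps :: "nat \<Rightarrow> nat \<Rightarrow> nat list" where
  "smith_exps p 0 = [0]"
| "smith_exps p (Suc a) = replicate (totient (p ^ Suc a)) 0 @ map Suc (smith_exps p a)"

lemma length_smith_exps:
  assumes "prime p"
  shows "length (smith_exps p a) = p ^ a"
proof (induction a)
  case (Suc a)
  then show ?case using totient_prime_power_Suc_add[OF assms, of a] by simp
qed simp

lemma sorted_smith_exps: "sorted (smith_exps p a)"
  by (induction a) (auto simp: sorted_append sorted_map)

text \<open>Reversal turns the increasing Smith order into the decreasing order of the theorem. In
  the induction step \<open>Suc (a - i) = Suc a - i\<close> holds because
  \<open>i \<le> a\<close>.\<close>

lemma rev_smith_exps:
  "rev (smith_exps p a) = concat (map (\<lambda>i. replicate (totient (p ^ i)) (a - i)) [0..<a + 1])"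
proof (induction a)
  case (Suc a)
  have "map Suc (rev (smith_exps p a)) =
      concat (map (\<lambda>i. replicate (totient (p ^ i)) (Suc a - i)) [0..<a + 1])"
    unfolding Suc.IH map_concat map_map o_def map_replicate
    by (intro arg_cong[of _ _ concat] map_cong) (auto simp: Suc_diff_le)
  then show ?case by (simp add: rev_map)
qed simp

section \<open>Rows and entries of the matrix at prime powers\<close>

lemma sorted_list_of_divisors_prime_power:
  fixes p :: nat
  assumes "prime p"
  shows "sorted_list_of_set {d. d dvd p ^ a} = map ((^) p) [0..<Suc a]"
proof (rule sorted_distinct_set_unique)
  have p1: "p > 1" using assms prime_gt_1_nat by blast
  have fin: "finite {d. d dvd p ^ a}" using p1 by (intro finite_divisors_nat) auto
  show "sorted (map ((^) p) [0..<Suc a])"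
    using p1 by (auto simp: sorted_iff_nth_mono power_increasing simp del: upt_Suc)
  show "distinct (map ((^) p) [0..<Suc a])"
    using p1 by (auto simp: distinct_map inj_on_def simp del: upt_Suc)
  show "set (sorted_list_of_set {d. d dvd p ^ a}) = set (map ((^) p) [0..<Suc a])"
    using fin by (auto simp: divides_primepow_nat[OF assms] less_Suc_eq_le simp del: upt_Suc)
qed auto

lemma psi_rows_1: "psi_rows 1 = [(1, 0)]"
  \<comment> \<open>Writing 1 as \<open>2 ^ 0\<close> makes it a prime power.\<close>
  using sorted_list_of_divisors_prime_power[of 2 0] by (simp add: psi_rows_def)

lemma psi_rows_prime_power_Suc:
  assumes "prime p"
  shows "psi_rows (p ^ Suc a) = psi_rows (p ^ a) @ map (Pair (p ^ Suc a)) [0..<totient (p ^ Suc a)]"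
  unfolding psi_rows_def sorted_list_of_divisors_prime_power[OF assms]
  by (simp del: power_Suc)

lemma fst_psi_rows_dvd: "k > 0 \<Longrightarrow> r \<in> set (psi_rows k) \<Longrightarrow> fst r dvd k"
  by (auto simp: psi_rows_def finite_divisors_nat)

lemma length_psi_rows:
  assumes "prime p"
  shows "length (psi_rows (p ^ a)) = p ^ a"
proof (induction a)
  case 0
  then show ?case using psi_rows_1 by simp
next
  case (Suc a)
  then show ?case
    using totient_prime_power_Suc_add[OF assms, of a] psi_rows_prime_power_Suc[OF assms, of a]
    by (simp del: power_Suc)
qed

lemma psi_matrix_carrier:
  "prime p \<Longrightarrow> psi_matrix (p ^ a) \<in> carrier_mat (p ^ a) (p ^ a)"
  by (simp add: psi_matrix_def length_psi_rows)

lemma xpow_mod_cyclo_prime_power_lt: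
  assumes p: "prime p" and "c < totient (p ^ a)"
  shows "xpow_mod_cyclo c (p ^ a) = monom 1 c"
  using assms by (intro xpow_mod_cyclo_prime_power_eqI) (auto simp: degree_monom_eq)

lemma psi_matrix_1: "psi_matrix 1 = 1\<^sub>m 1"
proof -
  have "xpow_mod_cyclo 0 (2 ^ 0) = monom 1 0"
    by (intro xpow_mod_cyclo_prime_power_lt) auto
  then show ?thesis unfolding psi_matrix_def psi_rows_1 by (intro eq_matI) auto
qed

text \<open>\<open>X^s\<close> times the cyclotomic polynomial is the sum of
  \<open>X^(m p^a + s)\<close> over \<open>m < p\<close>. Its top term \<open>m = p - 1\<close> is
  the monomial to be reduced, so the remainder is minus the rest.\<close>

lemma xpow_mod_cyclo_prime_power_ge:
  assumes p: "prime p" and s: "s < p ^ a"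
  shows "xpow_mod_cyclo (totient (p ^ Suc a) + s) (p ^ Suc a) = - (\<Sum>m<p - 1. monom 1 (m * p ^ a + s))"
proof (rule xpow_mod_cyclo_prime_power_eqI[OF p])
  let ?r = "\<Sum>m<p - 1. monom (1::int) (m * p ^ a + s)"
  have tot: "totient (p ^ Suc a) = (p - 1) * p ^ a"
    using totient_prime_power_Suc[OF p, of a] by simp
  have p1: "p > 1" using p prime_gt_1_nat by blast
  have "m * p ^ a + s < totient (p ^ Suc a)" if "m < p - 1" for m
  proof -
    have "m * p ^ a + s < Suc m * p ^ a" using s by simp
    also have "\<dots> \<le> (p - 1) * p ^ a" using that by (intro mult_le_mono1) auto
    finally show ?thesis using tot by simp
  qed
  then have "degree ?r < totient (p ^ Suc a)"
    using p1 by (intro degree_sum_less) (auto simp: degree_monom_eq simp del: power_Suc)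
  then show "- ?r = 0 \<or> degree (- ?r) < totient (p ^ Suc a)" by simp
  have "monom 1 (totient (p ^ Suc a) + s) - - ?r = (\<Sum>m<Suc (p - 1). monom 1 (m * p ^ a + s))"
    by (simp add: tot del: power_Suc)
  also have "\<dots> = monom 1 s * cyclotomic (p ^ Suc a)"
    using p1 unfolding cyclotomic_prime_power[OF p] by (simp add: sum_distrib_left mult_monom add.commute)
  finally show "cyclotomic (p ^ Suc a) dvd monom 1 (totient (p ^ Suc a) + s) - - ?r" by simp
qed

section \<open>Block recursion from \<open>p ^ a\<close> to \<open>p ^ Suc a\<close>\<close>

text \<open>Matrix of reduction modulo \<open>X^q - 1\<close> on polynomials of degree below
  \<open>m\<close>. Multiplying by it on the right repeats columns with period
  \<open>q\<close>.\<close>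

definition wrap_mat :: "nat \<Rightarrow> nat \<Rightarrow> int mat" where
  "wrap_mat q m = mat q m (\<lambda>(s, c). if c mod q = s then 1 else 0)"

lemma wrap_mat_carrier: "wrap_mat q m \<in> carrier_mat q m"
  by (simp add: wrap_mat_def)

lemma mult_wrap_mat_entry:
  assumes "A \<in> carrier_mat n q" "i < n" "c < m" "q > 0"
  shows "(A * wrap_mat q m) $$ (i, c) = A $$ (i, c mod q)"
proof -
  have "(\<Sum>k = 0..<q. A $$ (i, k) * wrap_mat q m $$ (k, c)) =
      (\<Sum>k = 0..<q. if k = c mod q then A $$ (i, c mod q) else 0)"
    using assms by (intro sum.cong) (auto simp: wrap_mat_def)
  then show ?thesis using assms by (simp add: scalar_prod_def wrap_mat_def)
qed

text \<open>Entry \<open>(i, j)\<close> counts the \<open>c < q * k\<close> whose residue is both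
  \<open>i\<close> and \<open>j\<close>; each residue occurs \<open>k\<close> times.\<close>

lemma wrap_mat_mult_transpose:
  assumes "q > 0"
  shows "wrap_mat q (q * k) * transpose_mat (wrap_mat q (q * k)) = int k \<cdot>\<^sub>m 1\<^sub>m q"
proof (rule eq_matI)
  fix i j assume "i < dim_row (int k \<cdot>\<^sub>m 1\<^sub>m q)" "j < dim_col (int k \<cdot>\<^sub>m 1\<^sub>m q)"
  then have ij: "i < q" "j < q" by auto
  have "(wrap_mat q (q * k) * transpose_mat (wrap_mat q (q * k))) $$ (i, j) =
      (\<Sum>c = 0..<q * k. if c mod q = i \<and> c mod q = j then 1 else 0)"
    using ij by (simp add: scalar_prod_def wrap_mat_def) (intro sum.cong, auto)
  also have "\<dots> = (if i = j then int (card {c \<in> {0..<q * k}. c mod q = i}) else 0)"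
    by (auto simp: sum.If_cases Int_def simp flip: of_nat_sum)
  also have "{c \<in> {0..<q * k}. c mod q = i} = (\<lambda>m. m * q + i) ` {0..<k}"
  proof (intro equalityI subsetI)
    fix c assume "c \<in> {c \<in> {0..<q * k}. c mod q = i}"
    then show "c \<in> (\<lambda>m. m * q + i) ` {0..<k}"
      using assms by (intro image_eqI[of _ _ "c div q"]) (auto simp: less_mult_imp_div_less mult.commute)
  next
    fix c assume "c \<in> (\<lambda>m. m * q + i) ` {0..<k}"
    then obtain m where m: "m < k" "c = m * q + i" by auto
    have "m * q + i < Suc m * q" using ij by simp
    also have "\<dots> \<le> k * q" using m by (intro mult_le_mono1) simp
    finally show "c \<in> {c \<in> {0..<q * k}. c mod q = i}" using m ij by (simp add: mult.commute)
  qed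
  also have "card \<dots> = k" using assms by (subst card_image) (auto simp: inj_on_def)
  finally show "(wrap_mat q (q * k) * transpose_mat (wrap_mat q (q * k))) $$ (i, j) =
      (int k \<cdot>\<^sub>m 1\<^sub>m q) $$ (i, j)"
    using ij by simp
qed (auto simp: wrap_mat_def)

text \<open>Modulo \<open>\<Phi>\<^sub>d\<close> with \<open>d\<close> dividing \<open>p ^ a\<close>, the powers of \<open>X\<close> are \<open>p ^ a\<close>-periodic; modulo
  \<open>\<Phi>\<^bsub>p ^ Suc a\<^esub>\<close>, the last \<open>p ^ a\<close> powers of \<open>X\<close> are minus the sum of the preceding ones in the
  same residue class.\<close>

lemma psi_matrix_prime_power_Suc:
  fixes p a :: nat
  assumes p: "prime p"
  defines "A \<equiv> psi_matrix (p ^ a)" and "m \<equiv> totient (p ^ Suc a)"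
  defines "K \<equiv> wrap_mat (p ^ a) m"
  shows "psi_matrix (p ^ Suc a) = four_block_mat (A * K) A (1\<^sub>m m) (- transpose_mat K)"
    (is "_ = ?B")
proof (rule eq_matI)
  let ?q = "p ^ a" and ?N = "p ^ Suc a"
  have q0: "?q > 0" using p prime_gt_0_nat by simp
  have A: "A \<in> carrier_mat ?q ?q" unfolding A_def by (rule psi_matrix_carrier[OF p])
  have K: "K \<in> carrier_mat ?q m" unfolding K_def by (rule wrap_mat_carrier)
  have mq: "m + ?q = ?N" unfolding m_def by (rule totient_prime_power_Suc_add[OF p])
  have m: "m = (p - 1) * ?q" unfolding m_def using totient_prime_power_Suc[OF p, of a] by simp
  have len: "length (psi_rows ?q) = ?q" "length (psi_rows ?N) = ?N"
    by (rule length_psi_rows[OF p])+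
  show "dim_row (psi_matrix ?N) = dim_row ?B" "dim_col (psi_matrix ?N) = dim_col ?B"
    using psi_matrix_carrier[OF p, of "Suc a"] A K mq by (auto simp: add.commute)
  fix i c assume "i < dim_row ?B" "c < dim_col ?B"
  then have ic: "i < ?N" "c < ?N" using A K mq by auto
  have lhs: "psi_matrix ?N $$ (i, c) =
      coeff (xpow_mod_cyclo c (fst (psi_rows ?N ! i))) (snd (psi_rows ?N ! i))"
    using ic by (simp add: psi_matrix_def len del: power_Suc)
  have rhs: "?B $$ (i, c) = (if i < ?q then if c < m then A $$ (i, c mod ?q) else A $$ (i, c - m)
      else if c < m then if i - ?q = c then 1 else 0 else - K $$ (c - m, i - ?q))"
    using ic A K mq mult_wrap_mat_entry[OF A, of i c m] q0 unfolding K_def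
    by (auto simp del: power_Suc)
  show "psi_matrix ?N $$ (i, c) = ?B $$ (i, c)"
  proof (cases "i < ?q")
    case True
    define r where "r = psi_rows ?q ! i"
    have r: "psi_rows ?N ! i = r"
      using True len unfolding psi_rows_prime_power_Suc[OF p] r_def by (simp add: nth_append)
    have "fst r dvd ?q" using True len q0 unfolding r_def by (intro fst_psi_rows_dvd) auto
    then have "xpow_mod_cyclo (c mod ?q) (fst r) = xpow_mod_cyclo c (fst r)"
      using cyclotomic_prime_power_dvd[OF p] divides_primepow_nat[OF p]
      by (metis xpow_mod_cyclo_mod)
    then have "psi_matrix ?N $$ (i, c) = A $$ (i, c mod ?q)"
      unfolding lhs r using True q0 by (simp add: A_def psi_matrix_def len r_def)
    \<comment> \<open>\<open>m\<close> is a multiple of \<open>p ^ a\<close>, and only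
      \<open>p ^ a\<close> columns remain after the first \<open>m\<close>.\<close>
    moreover have "c mod ?q = c - m" if "\<not> c < m"
    proof -
      have "c = (p - 1) * ?q + (c - m)" "c - m < ?q" using that ic mq m by auto
      then show ?thesis by (metis mod_less mod_mult_self3)
    qed
    ultimately show ?thesis unfolding rhs using True by auto
  next
    case False
    define t where "t = i - ?q"
    have t: "t < m" using False ic mq unfolding t_def by simp
    have r: "psi_rows ?N ! i = (?N, t)"
      using False len t unfolding psi_rows_prime_power_Suc[OF p] t_def m_def
      by (simp add: nth_append)
    show ?thesis
    proof (cases "c < m")
      case True
      then have "xpow_mod_cyclo c ?N = monom 1 c"
        unfolding m_def by (rule xpow_mod_cyclo_prime_power_lt[OF p])
      then show ?thesis unfolding lhs rhs r using False True by (auto simp: t_def)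
    next
      case c: False
      define s where "s = c - m"
      have s: "s < ?q" "c = m + s" using c ic mq by (auto simp: s_def)
      have "coeff (xpow_mod_cyclo c ?N) t = - (\<Sum>k<p - 1. if k * ?q + s = t then 1 else 0)"
        unfolding s(2) m_def xpow_mod_cyclo_prime_power_ge[OF p s(1)] by (simp add: coeff_sum)
      \<comment> \<open>At most one summand survives, the one with \<open>k = t div p ^ a\<close>.
        This index is in range because \<open>t < m = (p - 1) * p ^ a\<close>.\<close>
      also have "(\<Sum>k<p - 1. if k * ?q + s = t then 1 else 0) =
          (\<Sum>k<p - 1. if k = t div ?q then if t mod ?q = s then 1 else (0::int) else 0)"
      proof (rule sum.cong)
        fix k
        have "k * q + s = t \<longleftrightarrow> k = t div q \<and> t mod q = s" if "s < q" for q :: nat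
          using that by auto
        from this[OF s(1)] have "k * ?q + s = t \<longleftrightarrow> k = t div ?q \<and> t mod ?q = s" .
        then show "(if k * ?q + s = t then 1 else 0) =
            (if k = t div ?q then if t mod ?q = s then 1 else (0::int) else 0)" by auto
      qed simp
      also have "\<dots> = (if t mod ?q = s then 1 else 0)"
        using t unfolding m by (simp add: less_mult_imp_div_less)
      finally have "coeff (xpow_mod_cyclo c ?N) t = - K $$ (s, t)"
        using s(1) t by (simp add: K_def wrap_mat_def)
      then show ?thesis
        unfolding lhs rhs r using False c by (simp flip: s_def t_def)
    qed
  qed
qed

text \<open>\<open>L\<close> swaps the block rows and uses the identity block to clear
  \<open>M\<close>; \<open>R\<close> clears \<open>- J\<close> by adding multiples of the first
  columns. What remains in the corner is \<open>A + M * J = A + A * (K * J)\<close>, and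
  \<open>K * J\<close> is \<open>p - 1\<close> times the identity, whence \<open>p\<close> times
  \<open>A\<close>.\<close>

lemma psi_matrix_equiv_block_diag:
  fixes p a :: nat
  assumes p: "prime p"
  defines "q \<equiv> p ^ a" and "m \<equiv> totient (p ^ Suc a)"
  shows "\<exists>L R. L \<in> carrier_mat (m + q) (m + q) \<and> R \<in> carrier_mat (m + q) (m + q) \<and>
    invertible_mat L \<and> invertible_mat R \<and>
    L * psi_matrix (p ^ Suc a) * R =
      four_block_mat (1\<^sub>m m) (0\<^sub>m m q) (0\<^sub>m q m) (int p \<cdot>\<^sub>m psi_matrix q)"
proof -
  define A where "A = psi_matrix q"
  define K where "K = wrap_mat q m"
  define M where "M = A * K"
  define J where "J = transpose_mat K"
  define L where "L = four_block_mat (0\<^sub>m m q) (1\<^sub>m m) (1\<^sub>m q) (- M)"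
  define L' where "L' = four_block_mat M (1\<^sub>m q) (1\<^sub>m m) (0\<^sub>m m q)"
  define R where "R = four_block_mat (1\<^sub>m m) J (0\<^sub>m q m) (1\<^sub>m q)"
  define R' where "R' = four_block_mat (1\<^sub>m m) (- J) (0\<^sub>m q m) (1\<^sub>m q)"
  have q0: "q > 0" using p prime_gt_0_nat by (simp add: q_def)
  have A: "A \<in> carrier_mat q q" unfolding A_def q_def by (rule psi_matrix_carrier[OF p])
  have K: "K \<in> carrier_mat q m" unfolding K_def by (rule wrap_mat_carrier)
  have J: "J \<in> carrier_mat m q" using K by (simp add: J_def)
  have M: "M \<in> carrier_mat q m" using A K by (simp add: M_def)
  have L: "L \<in> carrier_mat (m + q) (m + q)"
    unfolding L_def using four_block_carrier_mat[of "0\<^sub>m m q" m q "- M" q m] M by (simp add: add.commute)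
  have L': "L' \<in> carrier_mat (m + q) (m + q)"
    unfolding L'_def using four_block_carrier_mat[of "M" q m "0\<^sub>m m q" m q] M by (simp add: add.commute)
  have R: "R \<in> carrier_mat (m + q) (m + q)" "R' \<in> carrier_mat (m + q) (m + q)"
    unfolding R_def R'_def by auto
  have MM: "M + - M = 0\<^sub>m q m" and JJ: "J + - J = 0\<^sub>m m q" using M J by (auto intro!: eq_matI)
  have Z: "- 0\<^sub>m k k = (0\<^sub>m k k :: int mat)" for k by (auto intro!: eq_matI)
  have "L * L' = 1\<^sub>m (m + q)"
    unfolding L_def L'_def using M
    by (subst mult_four_block_mat[of _ m q _ m _ q _ _ m _ q]) (auto simp: MM)
  moreover have "L' * L = 1\<^sub>m (m + q)"
    unfolding L_def L'_def using M
    by (subst mult_four_block_mat[of _ q m _ q _ m _ _ q _ m]) (auto simp: MM Z add.commute)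
  ultimately have Linv: "invertible_mat L" using L L' by (intro invertible_matI) 
  have "R * R' = 1\<^sub>m (m + q)"
    unfolding R_def R'_def using J
    by (subst mult_four_block_mat[of _ m m _ q _ q _ _ m _ q]) (auto simp: JJ Z)
  moreover have "R' * R = 1\<^sub>m (m + q)"
    unfolding R_def R'_def using J
    by (subst mult_four_block_mat[of _ m m _ q _ q _ _ m _ q]) (auto simp: JJ Z)
  ultimately have Rinv: "invertible_mat R" using R by (intro invertible_matI)
  have KJ: "K * J = int (p - 1) \<cdot>\<^sub>m 1\<^sub>m q"
    using wrap_mat_mult_transpose[OF q0, of "p - 1"] totient_prime_power_Suc[OF p, of a]
    unfolding K_def J_def m_def q_def by simp
  have "A + M * J = int p \<cdot>\<^sub>m A"
  proof -
    have "M * J = A * (K * J)" using A K J by (simp add: M_def)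
    also have "\<dots> = int (p - 1) \<cdot>\<^sub>m A"
      unfolding KJ using A by (subst mult_smult_distrib[of _ q q _ q]) auto
    finally show ?thesis
      using A prime_gt_0_nat[OF p] by (intro eq_matI) (auto simp: of_nat_diff algebra_simps)
  qed
  moreover have "psi_matrix (p ^ Suc a) = four_block_mat M A (1\<^sub>m m) (- J)"
    unfolding M_def A_def K_def J_def m_def q_def by (rule psi_matrix_prime_power_Suc[OF p])
  then have "L * psi_matrix (p ^ Suc a) = four_block_mat (1\<^sub>m m) (- J) (0\<^sub>m q m) (A + M * J)"
    unfolding L_def using A M J
    by (simp only:, subst mult_four_block_mat[of _ m q _ m _ q _ _ m _ q]) (auto simp: MM)
  ultimately have "L * psi_matrix (p ^ Suc a) * R =
      four_block_mat (1\<^sub>m m) (0\<^sub>m m q) (0\<^sub>m q m) (int p \<cdot>\<^sub>m A)"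
    unfolding R_def using A J
    by (simp, subst mult_four_block_mat[of _ m m _ q _ q _ _ m _ q]) auto
  then show ?thesis using L R Linv Rinv unfolding A_def by blast
qed

section \<open>Diagonalisation by induction on the exponent\<close>

definition smith_prime_power :: "nat \<Rightarrow> nat \<Rightarrow> int mat" where
  "smith_prime_power p a = mat_diag (p ^ a) (\<lambda>i. int p ^ (smith_exps p a ! i))"

lemma smith_prime_power_Suc:
  fixes p a :: nat
  assumes "prime p"
  defines "q \<equiv> p ^ a" and "m \<equiv> totient (p ^ Suc a)"
  shows "smith_prime_power p (Suc a) =
    four_block_mat (1\<^sub>m m) (0\<^sub>m m q) (0\<^sub>m q m) (int p \<cdot>\<^sub>m smith_prime_power p a)"
proof -
  have mq: "p ^ Suc a = m + q" unfolding q_def m_def using totient_prime_power_Suc_add[OF assms(1)] by simp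
  have len: "length (smith_exps p a) = q" unfolding q_def by (rule length_smith_exps[OF assms(1)])
  show ?thesis
    unfolding smith_prime_power_def mat_diag_def mq
    by (intro eq_matI) (auto simp: nth_append len m_def[symmetric] q_def[symmetric] power_Suc[of "int p"]
        simp del: power_Suc)
qed

lemma psi_matrix_equiv_smith_prime_power:
  assumes p: "prime p"
  shows "\<exists>P Q. P \<in> carrier_mat (p ^ a) (p ^ a) \<and> Q \<in> carrier_mat (p ^ a) (p ^ a) \<and>
    invertible_mat P \<and> invertible_mat Q \<and> smith_prime_power p a = P * psi_matrix (p ^ a) * Q"
proof (induction a)
  case 0
  have "smith_prime_power p 0 = 1\<^sub>m 1" by (auto simp: smith_prime_power_def mat_diag_def)
  moreover have "invertible_mat (1\<^sub>m 1 :: int mat)" by (rule invertible_matI[of _ 1 "1\<^sub>m 1"]) auto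
  ultimately show ?case using psi_matrix_1 by (intro exI[of _ "1\<^sub>m 1"]) auto
next
  case (Suc a)
  define q m where "q = p ^ a" and "m = totient (p ^ Suc a)"
  have mq: "p ^ Suc a = m + q" unfolding q_def m_def using totient_prime_power_Suc_add[OF p] by simp
  define A where "A = psi_matrix q"
  define B where "B = psi_matrix (p ^ Suc a)"
  have A: "A \<in> carrier_mat q q" unfolding A_def q_def by (rule psi_matrix_carrier[OF p])
  have B: "B \<in> carrier_mat (m + q) (m + q)" unfolding B_def mq[symmetric] by (rule psi_matrix_carrier[OF p])
  obtain P Q where PQ: "P \<in> carrier_mat q q" "Q \<in> carrier_mat q q" "invertible_mat P" "invertible_mat Q"
      "smith_prime_power p a = P * A * Q"
    using Suc.IH unfolding q_def A_def by blast
  obtain L R where LR: "L \<in> carrier_mat (m + q) (m + q)" "R \<in> carrier_mat (m + q) (m + q)"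
      "invertible_mat L" "invertible_mat R"
      "L * B * R = four_block_mat (1\<^sub>m m) (0\<^sub>m m q) (0\<^sub>m q m) (int p \<cdot>\<^sub>m A)"
    using psi_matrix_equiv_block_diag[OF p, of a] unfolding q_def m_def A_def B_def by blast
  \<comment> \<open>Bordering by an identity block is multiplicative and preserves invertibility, so
    the transformations \<open>P\<close>, \<open>Q\<close> of level \<open>a\<close> lift to
    \<open>D P\<close>, \<open>D Q\<close>. The scalar \<open>p\<close> passes through the
    product.\<close>
  define D where "D = (\<lambda>X :: int mat. four_block_mat (1\<^sub>m m) (0\<^sub>m m q) (0\<^sub>m q m) X)"
  have LRD: "L * B * R = D (int p \<cdot>\<^sub>m A)" using LR(5) by (simp add: D_def)
  have D: "D X \<in> carrier_mat (m + q) (m + q)" if "X \<in> carrier_mat q q" for X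
    using that by (simp add: D_def)
  have DD: "D X * D Y = D (X * Y)" if "X \<in> carrier_mat q q" "Y \<in> carrier_mat q q" for X Y
    unfolding D_def using that by (subst mult_four_block_mat[of _ m m _ q _ q _ _ m _ q]) auto
  have "smith_prime_power p (Suc a) = D (int p \<cdot>\<^sub>m (P * A * Q))"
    unfolding smith_prime_power_Suc[OF p] D_def PQ(5) q_def m_def by simp
  also have "\<dots> = D P * D (int p \<cdot>\<^sub>m A) * D Q"
    using PQ A by (simp add: DD mult_smult_distrib[of _ q q _ q] mult_smult_assoc_mat[of _ q q _ q])
  also have "\<dots> = (D P * L) * B * (R * D Q)"
    unfolding LRD[symmetric]
    using D[OF PQ(1)] D[OF PQ(2)] LR(1,2) B
    by (simp add: assoc_mult_mat[of _ "m + q" "m + q" _ "m + q" _ "m + q"])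
  finally have eq: "smith_prime_power p (Suc a) = (D P * L) * B * (R * D Q)" .
  have "invertible_mat (D P)" "invertible_mat (D Q)"
    unfolding D_def using PQ invertible_four_block_diag by blast+
  then have "invertible_mat (D P * L)" "invertible_mat (R * D Q)"
    using D PQ LR by (auto intro: invertible_mat_mult)
  then show ?case
    unfolding mq using eq D[OF PQ(1)] D[OF PQ(2)] LR(1,2) unfolding B_def mq
    by (intro exI[of _ "D P * L"] exI[of _ "R * D Q"]) auto
qed

lemma smith_nf_psi_matrix_prime_power:
  assumes p: "prime p"
  shows "smith_nf (psi_matrix (p ^ a)) = smith_prime_power p a"
proof (rule smith_nf_eqI[OF psi_matrix_carrier[OF p]])
  let ?A = "psi_matrix (p ^ a)" and ?S = "smith_prime_power p a"
  have A: "dim_row ?A = p ^ a" "dim_col ?A = p ^ a" using psi_matrix_carrier[OF p, of a] by auto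
  have "?S $$ (i, i) dvd ?S $$ (i + 1, i + 1)" if "i + 1 < p ^ a" for i
  proof -
    have "smith_exps p a ! i \<le> smith_exps p a ! (i + 1)"
      using sorted_nth_mono[OF sorted_smith_exps, of i "i + 1" p a] that length_smith_exps[OF p, of a]
      by simp
    then show ?thesis using that by (simp add: smith_prime_power_def mat_diag_def le_imp_power_dvd)
  qed
  then show "is_smith_nf ?A ?S"
    using psi_matrix_equiv_smith_prime_power[OF p, of a] unfolding is_smith_nf_def A
    by (auto simp: smith_prime_power_def mat_diag_def)
qed

lemma diag_mat_smith_prime_power:
  assumes "prime p"
  shows "diag_mat (smith_prime_power p a) = map (\<lambda>e. int p ^ e) (smith_exps p a)"
  by (rule nth_equalityI)
    (auto simp: diag_mat_def smith_prime_power_def mat_diag_def length_smith_exps[OF assms])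

section \<open>Kronecker products of diagonal matrices\<close>

lemma sorted_rev_concat_replicate:
  fixes m k :: nat
  shows "sorted (rev (concat (map (\<lambda>i. replicate (f i) (m - i)) [0..<k])))"
  by (induction k) (auto simp: sorted_append)

lemma mset_concat_replicate_mult:
  "mset (concat (map (\<lambda>i. replicate (f i * k) (g i)) is)) =
   repeat_mset k (mset (concat (map (\<lambda>i. replicate (f i) (g i)) is)))"
  by (induction "is") (auto simp: multiset_eq_iff algebra_simps)

lemma mset_concat_map_const:
  "mset (concat (map (\<lambda>_. ys) xs)) = repeat_mset (length xs) (mset ys)"
  by (induction xs) auto

lemma mset_concat_map_const_inner:
  "mset (concat (map (\<lambda>x. map (\<lambda>_. f x) ys) xs)) = repeat_mset (length ys) (mset (map f xs))"
  by (induction xs) (auto simp: map_replicate_const)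

text \<open>Splits \<open>[0..<m * n]\<close> into \<open>m\<close> runs of length \<open>n\<close>,
  which turns the \<open>div\<close>/\<open>mod\<close> indexing of \<open>kronecker\<close> into
  nested lists.\<close>

lemma map_div_mod_upt:
  fixes n :: nat
  shows "map (\<lambda>i. f (i div n) (i mod n)) [0..<m * n] = concat (map (\<lambda>i. map (f i) [0..<n]) [0..<m])"
proof (induction m)
  case (Suc m)
  have "[0..<Suc m * n] = [0..<m * n] @ map (\<lambda>i. i + m * n) [0..<n]"
    using upt_add_eq_append[of 0 "m * n" n] by (simp add: map_add_upt add.commute)
  then show ?case using Suc by simp
qed simp

lemma kronecker_carrier_mat:
  "A \<in> carrier_mat m m' \<Longrightarrow> B \<in> carrier_mat n n' \<Longrightarrow> kronecker A B \<in> carrier_mat (m * n) (m' * n')"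
  by (auto simp: kronecker_def)

lemma diag_mat_kronecker:
  assumes "A \<in> carrier_mat m m" "B \<in> carrier_mat n n"
  shows "diag_mat (kronecker A B) = concat (map (\<lambda>a. map ((*) a) (diag_mat B)) (diag_mat A))"
proof -
  have "diag_mat (kronecker A B) =
      map (\<lambda>i. A $$ (i div n, i div n) * B $$ (i mod n, i mod n)) [0..<m * n]"
    using assms by (auto simp: diag_mat_def kronecker_def)
  also have "\<dots> = concat (map (\<lambda>i. map (\<lambda>j. A $$ (i, i) * B $$ (j, j)) [0..<n]) [0..<m])"
    by (rule map_div_mod_upt)
  finally show ?thesis using assms by (simp add: diag_mat_def o_def)
qed

text \<open>Induction over the primes. The size, the positivity and prime divisors of the diagonal
  entries, and the exponents are carried together: positivity makes multiplicities additive, and the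
  bound on prime divisors makes the other factors invisible to \<open>p\<close>.\<close>

lemma kronecker_list_prime_power_diag:
  assumes "distinct ps" "\<And>p. p \<in> set ps \<Longrightarrow> prime p"
    and "\<And>p. p \<in> set ps \<Longrightarrow> S p \<in> carrier_mat (p ^ \<alpha> p) (p ^ \<alpha> p)"
    and "\<And>p. p \<in> set ps \<Longrightarrow> diag_mat (S p) = map (\<lambda>e. int p ^ e) (es p)"
  defines "N \<equiv> \<lambda>ps. \<Prod>p\<leftarrow>ps. p ^ \<alpha> p"
  shows "kronecker_list (map S ps) \<in> carrier_mat (N ps) (N ps) \<and>
    (\<forall>x \<in> set (diag_mat (kronecker_list (map S ps))).
        x > 0 \<and> (\<forall>q. prime q \<and> int q dvd x \<longrightarrow> q \<in> set ps)) \<and>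
    (\<forall>p \<in> set ps. mset (map (multiplicity (int p)) (diag_mat (kronecker_list (map S ps)))) =
        repeat_mset (N ps div p ^ \<alpha> p) (mset (es p)))"
  using assms(1-4)
proof (induction ps)
  case Nil
  have "\<not> int q dvd 1" if "prime q" for q :: nat
    using that not_prime_1 by auto
  then show ?case by (auto simp: N_def kronecker_list_def diag_mat_def)
next
  case (Cons p ps)
  let ?D = "kronecker_list (map S ps)" and ?D' = "kronecker_list (map S (p # ps))"
  have IH: "?D \<in> carrier_mat (N ps) (N ps)"
      "\<And>x. x \<in> set (diag_mat ?D) \<Longrightarrow> x > 0"
      "\<And>x q. x \<in> set (diag_mat ?D) \<Longrightarrow> prime q \<Longrightarrow> int q dvd x \<Longrightarrow> q \<in> set ps"
      "\<And>q. q \<in> set ps \<Longrightarrow> mset (map (multiplicity (int q)) (diag_mat ?D)) =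
         repeat_mset (N ps div q ^ \<alpha> q) (mset (es q))"
    using Cons.IH Cons.prems by auto
  have p: "prime p" "p \<notin> set ps" using Cons.prems by auto
  have p0: "int p > 0" using prime_gt_0_nat[OF p(1)] by simp
  have Sp: "S p \<in> carrier_mat (p ^ \<alpha> p) (p ^ \<alpha> p)" "diag_mat (S p) = map (\<lambda>e. int p ^ e) (es p)"
    using Cons.prems by auto
  have len: "length (es p) = p ^ \<alpha> p" 
    using arg_cong[OF Sp(2), of length] Sp(1) by (simp add: diag_mat_def)
  have len': "length (diag_mat ?D) = N ps" using IH(1) by (simp add: diag_mat_def)
  have D': "?D' = kronecker (S p) ?D" by (simp add: kronecker_list_def)
  have N: "N (p # ps) = p ^ \<alpha> p * N ps" by (simp add: N_def)
  have diag: "diag_mat ?D' = concat (map (\<lambda>e. map (\<lambda>b. int p ^ e * b) (diag_mat ?D)) (es p))"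
    unfolding D' diag_mat_kronecker[OF Sp(1) IH(1)] Sp(2) by (simp add: o_def)
  have "?D' \<in> carrier_mat (N (p # ps)) (N (p # ps))"
    unfolding D' N by (rule kronecker_carrier_mat[OF Sp(1) IH(1)])
  moreover have "x > 0 \<and> (\<forall>q. prime q \<and> int q dvd x \<longrightarrow> q \<in> set (p # ps))"
    if x: "x \<in> set (diag_mat ?D')" for x
  proof -
    obtain e b where eb: "x = int p ^ e * b" "b \<in> set (diag_mat ?D)"
      using x unfolding diag by auto
    have "q \<in> set (p # ps)" if q: "prime q" "int q dvd x" for q
    proof -
      have "prime (int q)" using q by simp
      then have "int q dvd int p \<or> int q dvd b"
        using q eb by (metis prime_dvd_mult_iff prime_dvd_power)
      then show ?thesis using IH(3)[OF eb(2) q(1)] primes_dvd_imp_eq[OF q(1) p(1)] by auto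
    qed
    then show ?thesis using eb IH(2)[OF eb(2)] p0 by auto
  qed
  moreover have "mset (map (multiplicity (int q)) (diag_mat ?D')) =
      repeat_mset (N (p # ps) div q ^ \<alpha> q) (mset (es q))" if q: "q \<in> set (p # ps)" for q
  proof -
    have pq: "prime (int q)" "int q \<noteq> 0" using Cons.prems(2)[OF q] by auto
    have mult: "multiplicity (int q) (int p ^ e * b) =
        multiplicity (int q) (int p ^ e) + multiplicity (int q) b"
      if "b \<in> set (diag_mat ?D)" for e b
      using IH(2)[OF that] p0 pq by (intro prime_elem_multiplicity_mult_distrib) auto
    show ?thesis
    proof (cases "q = p")
      \<comment> \<open>For the new prime the old diagonal contributes exponent 0, so each
        \<open>e\<close> is repeated \<open>N ps\<close> times.\<close>
      case True
      have "multiplicity (int p) b = 0" if "b \<in> set (diag_mat ?D)" for b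
        using IH(3)[OF that p(1)] p(2) by (intro not_dvd_imp_multiplicity_0) auto
      then have "map (multiplicity (int q)) (diag_mat ?D') =
          concat (map (\<lambda>e. map (\<lambda>_. e) (diag_mat ?D)) (es p))"
        unfolding diag map_concat map_map o_def using mult p pq True
        by (intro arg_cong[of _ _ concat] map_cong) (auto simp: multiplicity_same_power)
      then show ?thesis
        unfolding N using True p0 by (simp add: mset_concat_map_const_inner len')
    next
      \<comment> \<open>For an old prime the new factor contributes exponent 0, so the old exponents
        are repeated \<open>p ^ \<alpha> p\<close> times.\<close>
      case False
      then have q': "q \<in> set ps" using q by simp
      have "multiplicity (int q) (int p ^ e) = 0" for e
        using False p(1) pq primes_dvd_imp_eq[of q p] prime_dvd_power[of "int q" "int p" e]
        by (intro not_dvd_imp_multiplicity_0) auto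
      then have "map (multiplicity (int q)) (diag_mat ?D') =
          concat (map (\<lambda>_. map (multiplicity (int q)) (diag_mat ?D)) (es p))"
        unfolding diag map_concat map_map o_def using mult
        by (intro arg_cong[of _ _ concat] map_cong) auto
      then have "mset (map (multiplicity (int q)) (diag_mat ?D')) =
          repeat_mset (p ^ \<alpha> p * (N ps div q ^ \<alpha> q)) (mset (es q))"
        using IH(4)[OF q'] by (simp add: mset_concat_map_const len)
      \<comment> \<open>Makes the natural number division exact, so the factor
        \<open>p ^ \<alpha> p\<close> can be moved inside it.\<close>
      moreover have "q ^ \<alpha> q dvd N ps"
        unfolding N_def using split_list[OF q'] by auto
      ultimately show ?thesis unfolding N by (simp add: div_mult_swap)
    qed
  qed
  ultimately show ?case by blast
qed

section \<open>Combination over the primes dividing \<open>n\<close>\<close>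

theorem theorem2p16:
  fixes n :: nat
  assumes "n > 0"
  defines "D \<equiv> kronecker_list
                 (map (\<lambda>p. smith_nf (psi_matrix (p ^ multiplicity p n)))
                      (sorted_list_of_set (prime_factors n)))"
  shows "D \<in> carrier_mat n n
    \<and> {q :: nat. prime q \<and> (\<exists>i<n. int q dvd D $$ (i, i))} = prime_factors n
    \<and> (\<forall>p \<in> prime_factors n.
           rev (sort (map (\<lambda>i. multiplicity (int p) (D $$ (i, i))) [0..<n])) =
           concat (map (\<lambda>i. replicate (totient (p ^ i) * (n div p ^ multiplicity p n))
                                       (multiplicity p n - i))
                       [0..<multiplicity p n + 1]))"
proof -
  let ?ps = "sorted_list_of_set (prime_factors n)"
  let ?m = "\<lambda>p. multiplicity p n"
  have ps: "set ?ps = prime_factors n" "distinct ?ps" by auto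
  have pr: "prime p" if "p \<in> prime_factors n" for p using that by auto
  have "(\<Prod>p\<leftarrow>?ps. p ^ ?m p) = (\<Prod>p \<in> prime_factors n. p ^ ?m p)"
    using ps by (metis prod.distinct_set_conv_list)
  also have "\<dots> = n" using prime_factorization_nat[of n] assms by simp
  finally have N: "(\<Prod>p\<leftarrow>?ps. p ^ ?m p) = n" .
  have carr: "smith_nf (psi_matrix (p ^ ?m p)) \<in> carrier_mat (p ^ ?m p) (p ^ ?m p)"
    and diag: "diag_mat (smith_nf (psi_matrix (p ^ ?m p))) = map (\<lambda>e. int p ^ e) (smith_exps p (?m p))"
    if "p \<in> set ?ps" for p
    using that pr smith_nf_psi_matrix_prime_power diag_mat_smith_prime_power
    by (auto simp: smith_prime_power_def)
  note main = kronecker_list_prime_power_diag[of ?ps "\<lambda>p. smith_nf (psi_matrix (p ^ ?m p))" ?m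
      "\<lambda>p. smith_exps p (?m p)", OF ps(2) _ carr diag, unfolded N ps(1), folded D_def]
  have D: "D \<in> carrier_mat n n"
    and only: "\<And>x q. x \<in> set (diag_mat D) \<Longrightarrow> prime q \<Longrightarrow> int q dvd x \<Longrightarrow> q \<in> prime_factors n"
    and exps: "\<And>p. p \<in> prime_factors n \<Longrightarrow> mset (map (multiplicity (int p)) (diag_mat D)) =
        repeat_mset (n div p ^ ?m p) (mset (smith_exps p (?m p)))"
    using main pr by blast+
  have dm: "diag_mat D = map (\<lambda>i. D $$ (i, i)) [0..<n]" using D by (simp add: diag_mat_def)
  have only_idx: "q \<in> prime_factors n" if "i < n" "prime q" "int q dvd D $$ (i, i)" for i q
    using only[of "D $$ (i, i)" q] that unfolding dm by simp
  have ex: "\<exists>i<n. int p dvd D $$ (i, i)" if p: "p \<in> prime_factors n" for p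
  proof -
    \<comment> \<open>The block \<open>i = 0\<close> has length \<open>totient 1 = 1\<close> and
      supplies the largest exponent. As this exponent is positive and is repeated at least once,
      \<open>p\<close> divides some diagonal entry.\<close>
    have "?m p \<in> set (rev (smith_exps p (?m p)))"
      unfolding rev_smith_exps by (auto intro!: bexI[of _ 0])
    moreover have "n div p ^ ?m p > 0"
      using dvd_imp_le[OF multiplicity_dvd assms(1)] prime_gt_0_nat[OF pr[OF p]]
      by (simp add: div_greater_zero_iff)
    ultimately have "?m p \<in># mset (map (multiplicity (int p)) (diag_mat D))"
      unfolding exps[OF p] by (cases "n div p ^ ?m p") auto
    then obtain i where i: "i < n" "multiplicity (int p) (D $$ (i, i)) = ?m p"
      unfolding dm by auto
    moreover have "?m p > 0" using p by (simp add: prime_factors_multiplicity)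
    ultimately show ?thesis by (metis not_dvd_imp_multiplicity_0 less_irrefl)
  qed
  have "{q :: nat. prime q \<and> (\<exists>i<n. int q dvd D $$ (i, i))} = prime_factors n"
    using only_idx ex pr by blast
  moreover have "rev (sort (map (\<lambda>i. multiplicity (int p) (D $$ (i, i))) [0..<n])) =
      concat (map (\<lambda>i. replicate (totient (p ^ i) * (n div p ^ ?m p)) (?m p - i)) [0..<?m p + 1])"
    (is "rev (sort ?xs) = ?ys") if p: "p \<in> prime_factors n" for p
  proof -
    have "mset (rev ?ys) = mset ?xs"
      using exps[OF p] mset_concat_replicate_mult[of "\<lambda>i. totient (p ^ i)"]
        arg_cong[OF rev_smith_exps[of p "?m p"], of mset]
      unfolding dm by (simp add: o_def del: upt_Suc)
    \<comment> \<open>A sorted list with the same multiset of elements is the sorted list, so the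
      multiset count suffices.\<close>
    then have "sort ?xs = rev ?ys"
      using sorted_rev_concat_replicate by (intro properties_for_sort)
    then show ?thesis by simp
  qed
  ultimately show ?thesis using D by blast
qed

end
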